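(* Let $\mathfrak g=\mathfrak g(a,v,A)$ be a $2n$-dimensional almost abelian Lie algebra with Hermitian structure $(J,g)$. Then $(J,g)$ is LCSKT if and only if there exists a non-zero closed $1$-form $\alpha\in\mathfrak g^*$ such that the following conditions are satisfied for every $X,Y,Z\in\mathfrak n_1$: $$a\,\alpha(e_1)+\alpha(v)=0,\qquad A^t\,\alpha|_{\mathfrak n_1}=0,$$ $$\alpha(X)\,g(S(A)J_1Y,Z)-\alpha(Y)\,g(S(A)J_1X,Z)+\alpha(Z)\,g(S(A)J_1X,Y)=0,$$ $$g\big(S((a+\alpha(e_{2n}))A+A^2+A^tA)J_1Y,Z\big)=\tfrac12\big(g(v,Y)\alpha(Z)-g(v,Z)\alpha(Y)\big),$$ where $S(E)=\frac12(E+E^t)$ denotes the symmetric part of an endomorphism $E$ of $\mathfrak n_1$.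
   Context: A real Lie algebra is almost abelian if it contains a codimension-one abelian ideal $\mathfrak n$. Given a Hermitian structure $(J,g)$ on such a $2n$-dimensional $\mathfrak g$ ($J$ an endomorphism with $J^2=-\mathrm{Id}$ and vanishing Nijenhuis tensor, $g$ an inner product with $g(J\cdot,J\cdot)=g$), there is an orthonormal basis $\{e_1,\dots,e_{2n}\}$ with $\mathfrak n=\mathrm{span}\langle e_1,\dots,e_{2n-1}\rangle$, $\mathfrak n_1:=\mathfrak n\cap J\mathfrak n=\mathrm{span}\langle e_2,\dots,e_{2n-1}\rangle$, $Je_i=e_{2n+1-i}$ for $i=1,\dots,n$ (so $Je_1=e_{2n}$, $J\mathfrak n_1\subset\mathfrak n_1$). Put $J_1=J|_{\mathfrak n_1}$. The Lie brackets are $$[e_{2n},e_1]=ae_1+v,\qquad [e_{2n},X]=AX\ \ (X\in\mathfrak n_1),$$ with $a\in\mathbb R$, $v\in\mathfrak n_1$, $A\in\mathfrak{gl}(\mathfrak n_1)$, $[A,J_1]=0$; the Hermitian Lie algebra is denoted $\mathfrak g(a,v,A)$. $A^t$ is the transpose with respect to $g|_{\mathfrak n_1}$, and $A^t\alpha|_{\mathfrak n_1}=0$ means $\alpha(AX)=0$ for all $X\in\mathfrak n_1$. The fundamental form is $\Omega(X,Y)=g(JX,Y)$, the Bismut torsion $3$-form is $H=d^c\Omega$, i.e. $H(X,Y,Z)=-d\Omega(JX,JY,JZ)$ ($d$ the Chevalley–Eilenberg differential). $(J,g)$ is LCSKT if there is a non-zero closed $1$-form $\alpha$ on $\mathfrak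 g$ with $dH=\alpha\wedge H$. *)

theory Defs
  imports "HOL-Analysis.Analysis"
begin

text \<open>
  A Lie algebra is a Euclidean space \<open>'a\<close> with a bracket \<open>br\<close>; the class inner product
  plays the role of the metric \<open>g\<close>.
\<close>

definition lie_bracket :: "('a::real_vector \<Rightarrow> 'a \<Rightarrow> 'a) \<Rightarrow> bool" where
  "lie_bracket br \<longleftrightarrow>
     bilinear br \<and> (\<forall>x. br x x = 0) \<and>
     (\<forall>x y z. br x (br y z) + br y (br z x) + br z (br x y) = 0)"

definition codim_one_abelian_ideal ::
    "('a::euclidean_space \<Rightarrow> 'a \<Rightarrow> 'a) \<Rightarrow> 'a set \<Rightarrow> bool" where
  "codim_one_abelian_ideal br N \<longleftrightarrow>
     subspace N \<and> dim N + 1 = DIM('a) \<and>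
     (\<forall>x. \<forall>y\<in>N. br x y \<in> N) \<and> (\<forall>x\<in>N. \<forall>y\<in>N. br x y = 0)"

definition nijenhuis ::
    "('a::real_vector \<Rightarrow> 'a \<Rightarrow> 'a) \<Rightarrow> ('a \<Rightarrow> 'a) \<Rightarrow> 'a \<Rightarrow> 'a \<Rightarrow> 'a" where
  "nijenhuis br J x y = br (J x) (J y) - J (br (J x) y) - J (br x (J y)) - br x y"

definition hermitian_structure ::
    "('a::euclidean_space \<Rightarrow> 'a \<Rightarrow> 'a) \<Rightarrow> ('a \<Rightarrow> 'a) \<Rightarrow> bool" where
  "hermitian_structure br J \<longleftrightarrow>
     linear J \<and> (\<forall>x. J (J x) = - x) \<and> (\<forall>x y. nijenhuis br J x y = 0) \<and>
     (\<forall>x y. J x \<bullet> J y = x \<bullet> y)"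

definition adapted_basis ::
    "('a::euclidean_space \<Rightarrow> 'a) \<Rightarrow> 'a set \<Rightarrow> nat \<Rightarrow> (nat \<Rightarrow> 'a) \<Rightarrow> bool" where
  "adapted_basis J N n e \<longleftrightarrow>
     (\<forall>i\<in>{1..2*n}. \<forall>j\<in>{1..2*n}. e i \<bullet> e j = (if i = j then 1 else 0)) \<and>
     span (e ` {1..2*n}) = UNIV \<and>
     N = span (e ` {1..2*n-1}) \<and>
     N \<inter> J ` N = span (e ` {2..2*n-1}) \<and>
     (\<forall>i\<in>{1..n}. J (e i) = e (2*n+1-i))"

text \<open>
  Endomorphisms of a subspace \<open>V\<close> are functions on \<open>'a\<close> of which only the restriction to \<open>V\<close>
  matters.
\<close>

definition endo_on :: "'a::real_vector set \<Rightarrow> ('a \<Rightarrow> 'a) \<Rightarrow> bool" where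
  "endo_on V E \<longleftrightarrow>
     (\<forall>x\<in>V. E x \<in> V) \<and> (\<forall>x\<in>V. \<forall>y\<in>V. E (x + y) = E x + E y) \<and>
     (\<forall>c. \<forall>x\<in>V. E (c *\<^sub>R x) = c *\<^sub>R E x)"

text \<open>The library's \<open>adjoint\<close> is the adjoint on the whole space, not on \<open>V\<close>.\<close>

definition transpose_on :: "'a::real_inner set \<Rightarrow> ('a \<Rightarrow> 'a) \<Rightarrow> 'a \<Rightarrow> 'a" where
  "transpose_on V E y = (THE z. z \<in> V \<and> (\<forall>x\<in>V. E x \<bullet> y = x \<bullet> z))"

definition sym_part_on :: "'a::real_inner set \<Rightarrow> ('a \<Rightarrow> 'a) \<Rightarrow> 'a \<Rightarrow> 'a" where
  "sym_part_on V E x = (1/2) *\<^sub>R (E x + transpose_on V E x)"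

text \<open>
  A \<open>k\<close>-form is represented by a function on lists of vectors, of which only the values on lists
  of length \<open>k\<close> matter. In the Chevalley--Eilenberg differential
  \[ d\omega(x_0,\dots,x_k) = \sum_{i<j} (-1)^{i+j}
       \omega([x_i,x_j], x_0,\dots,\hat x_i,\dots,\hat x_j,\dots,x_k) \]
  and in the wedge product with a 1-form, \<open>nths xs (- I)\<close> deletes the entries with index in \<open>I\<close>.
\<close>

definition ce_diff ::
    "('a \<Rightarrow> 'a \<Rightarrow> 'a) \<Rightarrow> ('a list \<Rightarrow> real) \<Rightarrow> 'a list \<Rightarrow> real" where
  "ce_diff br \<omega> xs =
     (\<Sum>j<length xs. \<Sum>i<j. (-1) ^ (i + j) * \<omega> (br (xs ! i) (xs ! j) # nths xs (- {i, j})))"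

definition wedge_one :: "('a \<Rightarrow> real) \<Rightarrow> ('a list \<Rightarrow> real) \<Rightarrow> 'a list \<Rightarrow> real" where
  "wedge_one \<alpha> \<omega> xs = (\<Sum>i<length xs. (-1) ^ i * \<alpha> (xs ! i) * \<omega> (nths xs (- {i})))"

definition closed_one_form ::
    "('a::real_vector \<Rightarrow> 'a \<Rightarrow> 'a) \<Rightarrow> ('a \<Rightarrow> real) \<Rightarrow> bool" where
  "closed_one_form br \<alpha> \<longleftrightarrow>
     linear \<alpha> \<and> (\<forall>xs. length xs = 2 \<longrightarrow> ce_diff br (\<lambda>ys. \<alpha> (ys ! 0)) xs = 0)"

definition fundamental_form :: "('a::real_inner \<Rightarrow> 'a) \<Rightarrow> 'a list \<Rightarrow> real" where
  "fundamental_form J xs = J (xs ! 0) \<bullet> (xs ! 1)"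

definition bismut_torsion ::
    "('a::real_inner \<Rightarrow> 'a \<Rightarrow> 'a) \<Rightarrow> ('a \<Rightarrow> 'a) \<Rightarrow> 'a list \<Rightarrow> real" where
  "bismut_torsion br J xs = - ce_diff br (fundamental_form J) (map J xs)"

definition lcskt :: "('a::real_inner \<Rightarrow> 'a \<Rightarrow> 'a) \<Rightarrow> ('a \<Rightarrow> 'a) \<Rightarrow> bool" where
  "lcskt br J \<longleftrightarrow>
     (\<exists>\<alpha>. closed_one_form br \<alpha> \<and> \<alpha> \<noteq> (\<lambda>_. 0) \<and>
        (\<forall>xs. length xs = 4 \<longrightarrow>
           ce_diff br (bismut_torsion br J) xs = wedge_one \<alpha> (bismut_torsion br J) xs))"

end

theory Submission
  imports Defs
begin

text \<open>
  Write \<open>\<gamma> = \<langle>\<cdot>, e\<^sub>1\<rangle>\<close>, \<open>\<beta> = \<langle>\<cdot>, e\<^sub>2\<^sub>n\<rangle>\<close> and \<open>D = ad e\<^sub>2\<^sub>n\<close>. As \<open>\<nn>\<close> is abelian, the whole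
  bracket is \<open>[x, y] = \<beta>(x) D y - \<beta>(y) D x\<close>. Since \<open>\<beta> \<circ> J = \<gamma>\<close>, substituting this in
  \<open>H = d\<^sup>c\<Omega>\<close> shows that the torsion is divisible by \<open>\<gamma>\<close>:
  \<open>H = \<gamma> \<and> \<omega>\<close> with \<open>\<omega>(x, y) = \<langle>D J x, y\<rangle> - \<langle>D J y, x\<rangle>\<close> (lemma \<open>torsion_eq\<close>).
  Now \<open>d\<gamma> = - a \<beta> \<and> \<gamma>\<close>, and \<open>d\<omega> = - \<beta> \<and> (\<omega>(D\<cdot>, \<cdot>) + \<omega>(\<cdot>, D\<cdot>))\<close>. Consequently
  \<open>dH - \<alpha> \<and> H = \<gamma> \<and> \<Psi>\<close> where
  \<open>\<Psi> = \<beta> \<and> (a \<omega> + \<omega>(D\<cdot>, \<cdot>) + \<omega>(\<cdot>, D\<cdot>)) + \<alpha> \<and> \<omega>\<close> (lemma \<open>lcskt_defect_eq\<close>).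

  The 4-form \<open>\<gamma> \<and> \<Psi>\<close> vanishes iff the 3-form \<open>\<Psi>\<close> vanishes on
  \<open>ker \<gamma> = \<nn>\<^sub>1 \<oplus> \<real>e\<^sub>2\<^sub>n\<close>, that is, iff \<open>\<Psi>(X, Y, Z) = 0\<close> and \<open>\<Psi>(e\<^sub>2\<^sub>n, Y, Z) = 0\<close> for all
  \<open>X, Y, Z \<in> \<nn>\<^sub>1\<close>. On \<open>\<nn>\<^sub>1\<close> the form \<open>\<omega>\<close> is \<open>2 \<langle>S(A) J Y, Z\<rangle>\<close>, because \<open>J\<close> is
  skew and commutes with \<open>A\<close>; so the first family of equations is the third condition of the
  theorem, and, using \<open>\<omega>(e\<^sub>2\<^sub>n, Z) = - \<langle>v, Z\<rangle>\<close>, the second family is the fourth condition.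
  The first two conditions only say that \<open>\<alpha>\<close> vanishes on the brackets \<open>[e\<^sub>2\<^sub>n, \<cdot>]\<close>, so
  they hold for every closed \<open>\<alpha>\<close>. The equivalence therefore holds for each
  closed \<open>\<alpha>\<close> separately.
\<close>

section \<open>The transpose on a subspace\<close>

lemma transpose_on_eqI:
  assumes V: "subspace V" and z: "z \<in> V" "\<And>x. x \<in> V \<Longrightarrow> E x \<bullet> y = x \<bullet> z"
  shows "transpose_on V E y = z"
  unfolding transpose_on_def
proof (rule the_equality)
  fix z' assume z': "z' \<in> V \<and> (\<forall>x\<in>V. E x \<bullet> y = x \<bullet> z')"
  then have "z' - z \<in> V" using V z by (simp add: subspace_diff)
  then have "(z' - z) \<bullet> (z' - z) = 0"
    using z z' by (metis inner_diff_right right_minus_eq)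
  then show "z' = z" by simp
qed (use z in auto)

text \<open>
  The representing vector is \<open>\<Sum>b\<in>B. (E b \<bullet> y) b\<close> for an orthonormal basis \<open>B\<close> of \<open>V\<close>.
\<close>

lemma transpose_on_exists:
  fixes V :: "'a::euclidean_space set"
  assumes V: "subspace V" and E: "endo_on V E"
  shows "\<exists>z\<in>V. \<forall>x\<in>V. E x \<bullet> y = x \<bullet> z"
proof -
  obtain B where B: "B \<subseteq> V" "pairwise orthogonal B" "\<And>x. x \<in> B \<Longrightarrow> norm x = 1"
    "independent B" "span B = V"
    using orthonormal_basis_subspace[OF V] by metis
  have fin: "finite B" using B(4) by (rule independent_imp_finite)
  define z where "z = (\<Sum>b\<in>B. (E b \<bullet> y) *\<^sub>R b)"
  have zV: "z \<in> V" unfolding z_def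
    using B(1) by (intro subspace_sum[OF V] subspace_scale[OF V]) auto
  have onb: "E b \<bullet> y = b \<bullet> z" if b: "b \<in> B" for b
  proof -
    have "b \<bullet> z = (\<Sum>c\<in>B. (E c \<bullet> y) * (b \<bullet> c))"
      by (simp add: z_def inner_sum_right)
    also have "\<dots> = (\<Sum>c\<in>B. if c = b then E b \<bullet> y else 0)"
    proof (rule sum.cong)
      fix c assume c: "c \<in> B"
      show "(E c \<bullet> y) * (b \<bullet> c) = (if c = b then E b \<bullet> y else 0)"
        using B(2) B(3)[OF b] b c
        by (auto simp: pairwise_def orthogonal_def norm_eq_1)
    qed simp
    also have "\<dots> = E b \<bullet> y" using b fin by simp
    finally show ?thesis by simp
  qed
  have E0: "E 0 = 0"
    using E subspace_0[OF V] unfolding endo_on_def by (metis scale_zero_left)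
  have "subspace {x \<in> V. E x \<bullet> y = x \<bullet> z}"
    using V E E0 unfolding subspace_def endo_on_def
    by (auto simp: inner_left_distrib)
  moreover have "B \<subseteq> {x \<in> V. E x \<bullet> y = x \<bullet> z}" using onb B(1) by auto
  ultimately have "span B \<subseteq> {x \<in> V. E x \<bullet> y = x \<bullet> z}" by (rule span_minimal[rotated])
  then show ?thesis using zV B(5) by auto
qed

lemma
  fixes V :: "'a::euclidean_space set"
  assumes "subspace V" and "endo_on V E"
  shows transpose_on_in: "transpose_on V E y \<in> V"
    and inner_transpose_on: "x \<in> V \<Longrightarrow> x \<bullet> transpose_on V E y = E x \<bullet> y"
  using transpose_on_exists[OF assms, of y] transpose_on_eqI[OF assms(1), of _ E y] by metis+

lemma endo_on_transpose_on:
  fixes V :: "'a::euclidean_space set"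
  assumes "subspace V" and "endo_on V E"
  shows "endo_on V (transpose_on V E)"
  unfolding endo_on_def
proof (intro conjI ballI allI)
  fix x y c
  show "transpose_on V E x \<in> V" using assms by (rule transpose_on_in)
  show "transpose_on V E (x + y) = transpose_on V E x + transpose_on V E y"
    using assms
    by (intro transpose_on_eqI)
      (auto simp: subspace_add transpose_on_in inner_transpose_on inner_right_distrib)
  show "transpose_on V E (c *\<^sub>R x) = c *\<^sub>R transpose_on V E x"
    using assms
    by (intro transpose_on_eqI)
      (auto simp: subspace_scale transpose_on_in inner_transpose_on)
qed

lemma inner_sym_part_on:
  fixes V :: "'a::euclidean_space set"
  assumes "subspace V" and "endo_on V E" and "Z \<in> V"
  shows "sym_part_on V E X \<bullet> Z = (E X \<bullet> Z + E Z \<bullet> X) / 2"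
  using inner_transpose_on[OF assms(1,2,3), of X]
  by (simp add: sym_part_on_def inner_left_distrib inner_commute[of Z])

section \<open>Low-degree forms\<close>

lemma ce_diff_2: "ce_diff br \<omega> [x, y] = - \<omega> [br x y]"
  by (simp add: ce_diff_def nths_Cons numeral_eq_Suc lessThan_Suc)

lemma ce_diff_3:
  "ce_diff br \<omega> [x, y, z] = - \<omega> [br x y, z] + \<omega> [br x z, y] - \<omega> [br y z, x]"
  by (simp add: ce_diff_def nths_Cons numeral_eq_Suc lessThan_Suc)

lemma ce_diff_4:
  "ce_diff br \<omega> [x, y, z, w] =
     - \<omega> [br x y, z, w] + \<omega> [br x z, y, w] - \<omega> [br x w, y, z]
     - \<omega> [br y z, x, w] + \<omega> [br y w, x, z] - \<omega> [br z w, x, y]"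
  by (simp add: ce_diff_def nths_Cons numeral_eq_Suc lessThan_Suc)

lemma wedge_one_4:
  "wedge_one \<alpha> \<omega> [x, y, z, w] =
     \<alpha> x * \<omega> [y, z, w] - \<alpha> y * \<omega> [x, z, w] + \<alpha> z * \<omega> [x, y, w] - \<alpha> w * \<omega> [x, y, z]"
  by (simp add: wedge_one_def nths_Cons numeral_eq_Suc lessThan_Suc)

lemma all_length_2: "(\<forall>xs. length xs = 2 \<longrightarrow> P xs) \<longleftrightarrow> (\<forall>x y. P [x, y])"
  by (auto simp: numeral_eq_Suc length_Suc_conv)

lemma all_length_4: "(\<forall>xs. length xs = 4 \<longrightarrow> P xs) \<longleftrightarrow> (\<forall>x y z w. P [x, y, z, w])"
  by (auto simp: numeral_eq_Suc length_Suc_conv)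

lemma closed_one_form_iff:
  "closed_one_form br \<alpha> \<longleftrightarrow> linear \<alpha> \<and> (\<forall>x y. \<alpha> (br x y) = 0)"
  by (simp add: closed_one_form_def all_length_2 ce_diff_2)

definition alternating3 :: "('a::real_vector \<Rightarrow> 'a \<Rightarrow> 'a \<Rightarrow> real) \<Rightarrow> bool" where
  "alternating3 T \<longleftrightarrow>
     (\<forall>y z. linear (\<lambda>x. T x y z)) \<and>
     (\<forall>x y z. T y x z = - T x y z) \<and> (\<forall>x y z. T x z y = - T x y z)"

lemma alternating3_lin:
  assumes "alternating3 T"
  shows "T (x + x') y z = T x y z + T x' y z" "T x (y + y') z = T x y z + T x y' z"
    "T x y (z + z') = T x y z + T x y z'"
    "T (c *\<^sub>R x) y z = c * T x y z" "T x (c *\<^sub>R y) z = c * T x y z" "T x y (c *\<^sub>R z) = c * T x y z"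
proof -
  have l: "linear (\<lambda>x. T x y z)" and s: "T y x z = - T x y z" "T x z y = - T x y z" for x y z
    using assms unfolding alternating3_def by blast+
  have a: "T (x + x') y z = T x y z + T x' y z" and m: "T (c *\<^sub>R x) y z = c * T x y z" for x x' y z c
    using linear_add[OF l] linear_scale[OF l] by auto
  have b: "T x (y + y') z = T x y z + T x y' z" and n: "T x (c *\<^sub>R y) z = c * T x y z" for x y y' z c
    using s(1)[of x] a m by (smt (verit) mult_minus_right)+
  show "T (x + x') y z = T x y z + T x' y z" "T x (y + y') z = T x y z + T x y' z"
    "T (c *\<^sub>R x) y z = c * T x y z" "T x (c *\<^sub>R y) z = c * T x y z"
    by (rule a b m n)+
  show "T x y (z + z') = T x y z + T x y z'" "T x y (c *\<^sub>R z) = c * T x y z"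
    using s(2)[of x y] b n by (smt (verit) mult_minus_right)+
qed

text \<open>
  Interior multiplication with \<open>u\<close> turns \<open>\<gamma> \<and> T = 0\<close> into \<open>T = \<gamma> \<and> (\<iota>\<^sub>u T)\<close>, which
  vanishes on \<open>ker \<gamma>\<close>. Conversely, let \<open>P x = x - \<gamma>(x) u\<close> be the projection to \<open>ker \<gamma>\<close>. If
  \<open>T\<close> vanishes on \<open>ker \<gamma>\<close>, then expanding \<open>T (P x) (P y) (P z) = 0\<close> gives back
  \<open>T = \<gamma> \<and> (\<iota>\<^sub>u T)\<close>, and so \<open>\<gamma> \<and> T = 0\<close>.
\<close>

lemma wedge_alternating3_eq_0_iff:
  assumes T: "alternating3 T" and \<gamma>: "linear \<gamma>" "\<gamma> u = 1"
  shows "(\<forall>x y z w. \<gamma> x * T y z w - \<gamma> y * T x z w + \<gamma> z * T x y w - \<gamma> w * T x y z = 0) \<longleftrightarrow>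
    (\<forall>x y z. \<gamma> x = 0 \<longrightarrow> \<gamma> y = 0 \<longrightarrow> \<gamma> z = 0 \<longrightarrow> T x y z = (0::real))" (is "?L \<longleftrightarrow> ?R")
proof
  assume L: ?L
  show ?R
  proof (intro allI impI)
    fix x y z assume "\<gamma> x = 0" "\<gamma> y = 0" "\<gamma> z = 0"
    then show "T x y z = 0" using L[rule_format, of u x y z] \<gamma>(2) by simp
  qed
next
  assume R: ?R
  have s: "T y x z = - T x y z" "T x z y = - T x y z" for x y z
    using T unfolding alternating3_def by blast+
  have z: "T x x y = 0" "T x y x = 0" "T x y y = 0" for x y
    using s(1)[of x x y] s(2)[of x y y] s(2)[of x x y] by auto
  define P where "P x = x + (- \<gamma> x) *\<^sub>R u" for x
  have "\<gamma> (P x) = 0" for x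
    using \<gamma> by (simp add: P_def linear_add linear_scale linear_diff)
  then have TP: "T (P x) (P y) (P z) = 0" for x y z using R by simp
  have e: "T x y z = \<gamma> x * T u y z - \<gamma> y * T u x z + \<gamma> z * T u x y" for x y z
    using TP[of x y z] unfolding P_def alternating3_lin[OF T]
    by (simp add: s(1)[of u x z] s(2)[of x u y] s(1)[of u x y] s(1)[of u x u] z algebra_simps)
  show ?L
  proof (intro allI)
    fix x y z w
    show "\<gamma> x * T y z w - \<gamma> y * T x z w + \<gamma> z * T x y w - \<gamma> w * T x y z = 0"
      unfolding e[of y z w] e[of x z w] e[of x y w] e[of x y z] by (simp add: algebra_simps)
  qed
qed

section \<open>Torsion of an almost abelian Hermitian Lie algebra\<close>

text \<open>
  The data read off from an adapted basis: \<open>e1\<close> and \<open>U\<close> are its first and last vector, and \<open>V\<close>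
  is the maximal \<open>J\<close>-invariant subspace of the abelian ideal. The ideal itself does not
  appear: it is the hyperplane orthogonal to \<open>U\<close>.
\<close>

locale almost_abelian_hermitian =
  fixes br :: "'a::euclidean_space \<Rightarrow> 'a \<Rightarrow> 'a"
    and J A :: "'a \<Rightarrow> 'a" and V :: "'a set" and e1 U v :: 'a and a :: real
  assumes br: "bilinear br" "\<And>x. br x x = 0"
    and J: "linear J" "\<And>x. J (J x) = - x" "\<And>x y. J x \<bullet> J y = x \<bullet> y"
    and V: "subspace V" "\<And>X. X \<in> V \<Longrightarrow> J X \<in> V"
    and A: "endo_on V A" "\<And>X. X \<in> V \<Longrightarrow> A (J X) = J (A X)"
    and e1: "e1 \<bullet> e1 = 1" "J e1 = U"
    and perp: "\<And>X. X \<in> V \<Longrightarrow> X \<bullet> e1 = 0" "\<And>X. X \<in> V \<Longrightarrow> X \<bullet> U = 0" "e1 \<bullet> U = 0"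
    and decomp: "\<And>x. \<exists>X\<in>V. x = (x \<bullet> e1) *\<^sub>R e1 + X + (x \<bullet> U) *\<^sub>R U"
    and v: "v \<in> V"
    and abelian: "\<And>x y. x \<bullet> U = 0 \<Longrightarrow> y \<bullet> U = 0 \<Longrightarrow> br x y = 0"
    and br_U_e1: "br U e1 = a *\<^sub>R e1 + v"
    and br_U: "\<And>X. X \<in> V \<Longrightarrow> br U X = A X"
begin

lemma U_unit: "U \<bullet> U = 1"
  using J(3)[of e1 e1] e1 by simp

lemma J_U: "J U = - e1"
  using J(2)[of e1] e1 by simp

lemma J_skew: "J x \<bullet> y = - (x \<bullet> J y)"
  using J(3)[of x "J y"] J(2)[of y] by simp

lemma J_inner_U: "J x \<bullet> U = x \<bullet> e1"
  using J(3)[of x e1] e1 by simp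

lemma A_in: "X \<in> V \<Longrightarrow> A X \<in> V"
  using A(1) by (simp add: endo_on_def)

text \<open>The abelian ideal reduces the bracket to the single operator \<open>ad U\<close>.\<close>

lemma br_eq: "br x y = (x \<bullet> U) *\<^sub>R br U y - (y \<bullet> U) *\<^sub>R br U x"
proof -
  define x' y' where "x' = x - (x \<bullet> U) *\<^sub>R U" and "y' = y - (y \<bullet> U) *\<^sub>R U"
  have "br x' y' = 0"
    by (rule abelian) (simp_all add: x'_def y'_def inner_diff_left U_unit)
  moreover have "br x U = - br U x"
    using br(2)[of "x + U"] br(2)[of x] br(2)[of U]
    by (simp add: bilinear_ladd[OF br(1)] bilinear_radd[OF br(1)] add_eq_0_iff)
  ultimately show ?thesis
    by (simp add: x'_def y'_def bilinear_lsub[OF br(1)] bilinear_rsub[OF br(1)]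
        bilinear_lmul[OF br(1)] bilinear_rmul[OF br(1)] br(2) algebra_simps)
qed

lemma br_U_inner_e1: "br U x \<bullet> e1 = a * (x \<bullet> e1)"
proof -
  obtain X where X: "X \<in> V" and x: "x = (x \<bullet> e1) *\<^sub>R e1 + X + (x \<bullet> U) *\<^sub>R U"
    using decomp by blast
  have "br U x = (x \<bullet> e1) *\<^sub>R (a *\<^sub>R e1 + v) + A X"
    by (subst x) (simp add: bilinear_radd[OF br(1)] bilinear_rmul[OF br(1)] br(2) br_U_e1 br_U[OF X])
  then show ?thesis using perp(1)[OF v] perp(1)[OF A_in[OF X]] e1
    by (simp add: inner_left_distrib)
qed

lemma br_inner_e1: "br x y \<bullet> e1 = a * ((x \<bullet> U) * (y \<bullet> e1) - (y \<bullet> U) * (x \<bullet> e1))"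
  by (subst br_eq) (simp add: inner_diff_left br_U_inner_e1 algebra_simps)

lemma br_U_inner_U: "br U x \<bullet> U = 0"
proof -
  obtain X where X: "X \<in> V" and x: "x = (x \<bullet> e1) *\<^sub>R e1 + X + (x \<bullet> U) *\<^sub>R U"
    using decomp by blast
  have "br U x = (x \<bullet> e1) *\<^sub>R (a *\<^sub>R e1 + v) + A X"
    by (subst x) (simp add: bilinear_radd[OF br(1)] bilinear_rmul[OF br(1)] br(2) br_U_e1 br_U[OF X])
  then show ?thesis using perp v A_in[OF X] by (simp add: inner_left_distrib)
qed

definition \<omega> :: "'a \<Rightarrow> 'a \<Rightarrow> real" where
  "\<omega> x y = br U (J x) \<bullet> y - br U (J y) \<bullet> x"

lemma \<omega>_skew: "\<omega> y x = - \<omega> x y"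
  by (simp add: \<omega>_def)

lemma \<omega>_add_left: "\<omega> (x + x') y = \<omega> x y + \<omega> x' y"
  and \<omega>_scale_left: "\<omega> (c *\<^sub>R x) y = c * \<omega> x y"
  by (simp_all add: \<omega>_def linear_add[OF J(1)] linear_scale[OF J(1)] bilinear_radd[OF br(1)]
      bilinear_rmul[OF br(1)] inner_left_distrib inner_right_distrib algebra_simps)

lemma \<omega>_add_right: "\<omega> y (x + x') = \<omega> y x + \<omega> y x'"
  and \<omega>_scale_right: "\<omega> y (c *\<^sub>R x) = c * \<omega> y x"
  by (simp_all add: \<omega>_skew[of y] \<omega>_add_left \<omega>_scale_left)

lemma \<omega>_br: "\<omega> (br x y) z = (x \<bullet> U) * \<omega> (br U y) z - (y \<bullet> U) * \<omega> (br U x) z"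
proof -
  have "br x y = (x \<bullet> U) *\<^sub>R br U y + (- (y \<bullet> U)) *\<^sub>R br U x"
    by (subst br_eq) simp
  then show ?thesis by (simp only: \<omega>_add_left \<omega>_scale_left)
qed

text \<open>The torsion is \<open>\<gamma> \<and> \<omega>\<close>, since \<open>[J x, J y] = \<gamma>(x) D J y - \<gamma>(y) D J x\<close>.\<close>

lemma torsion_eq:
  "bismut_torsion br J [x, y, z] =
     (x \<bullet> e1) * \<omega> y z - (y \<bullet> e1) * \<omega> x z + (z \<bullet> e1) * \<omega> x y"
proof -
  have *: "br (J x) (J y) \<bullet> z = (x \<bullet> e1) * (br U (J y) \<bullet> z) - (y \<bullet> e1) * (br U (J x) \<bullet> z)" for x y z
    by (subst br_eq) (simp add: J_inner_U inner_diff_left)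
  show ?thesis
    by (simp add: bismut_torsion_def ce_diff_3 fundamental_form_def J(3) \<omega>_def * algebra_simps)
qed

text \<open>
  The form \<open>a \<omega> + \<omega>(D\<cdot>, \<cdot>) + \<omega>(\<cdot>, D\<cdot>)\<close> with \<open>D = ad U\<close>. The last term carries \<open>D\<close> in the first
  argument, at the price of a sign, because \<open>\<omega>\<close> is paired with a bracket only there in \<open>dH\<close>.
\<close>

definition D_\<omega> :: "'a \<Rightarrow> 'a \<Rightarrow> real" where
  "D_\<omega> x y = a * \<omega> x y + \<omega> (br U x) y - \<omega> (br U y) x"

definition \<Psi> :: "('a \<Rightarrow> real) \<Rightarrow> 'a \<Rightarrow> 'a \<Rightarrow> 'a \<Rightarrow> real" where
  "\<Psi> \<alpha> x y z =
     (x \<bullet> U) * D_\<omega> y z - (y \<bullet> U) * D_\<omega> x z + (z \<bullet> U) * D_\<omega> x y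
     + (\<alpha> x * \<omega> y z - \<alpha> y * \<omega> x z + \<alpha> z * \<omega> x y)"

text \<open>
  The Leibniz rule for \<open>d(\<gamma> \<and> \<omega>)\<close>: the summand \<open>a \<omega>\<close> of \<open>D_\<omega>\<close> comes from
  \<open>d\<gamma> = - a \<beta> \<and> \<gamma>\<close>, and \<open>\<alpha> \<and> H\<close> contributes \<open>- \<alpha> \<and> \<gamma> \<and> \<omega> = \<gamma> \<and> \<alpha> \<and> \<omega>\<close>.
\<close>

lemma lcskt_defect_eq:
  "ce_diff br (bismut_torsion br J) [x, y, z, w] - wedge_one \<alpha> (bismut_torsion br J) [x, y, z, w] =
     (x \<bullet> e1) * \<Psi> \<alpha> y z w - (y \<bullet> e1) * \<Psi> \<alpha> x z w + (z \<bullet> e1) * \<Psi> \<alpha> x y w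
     - (w \<bullet> e1) * \<Psi> \<alpha> x y z"
  by (simp add: ce_diff_4 wedge_one_4 torsion_eq br_inner_e1 \<Psi>_def D_\<omega>_def
      \<omega>_br[of x y] \<omega>_br[of x z] \<omega>_br[of x w] \<omega>_br[of y z] \<omega>_br[of y w] \<omega>_br[of z w]
      algebra_simps)

lemma alternating3_\<Psi>:
  assumes "linear \<alpha>"
  shows "alternating3 (\<Psi> \<alpha>)"
proof -
  have D_skew: "D_\<omega> y x = - D_\<omega> x y" for x y
    using \<omega>_skew[of x y] by (simp add: D_\<omega>_def)
  have "linear (\<lambda>x. \<Psi> \<alpha> x y z)" for y z
    by (rule linearI)
      (simp_all add: \<Psi>_def D_\<omega>_def linear_add[OF assms] linear_scale[OF assms] inner_left_distrib
        \<omega>_add_left \<omega>_scale_left \<omega>_add_right \<omega>_scale_right bilinear_radd[OF br(1)]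
        bilinear_rmul[OF br(1)] algebra_simps)
  moreover have "\<Psi> \<alpha> y x z = - \<Psi> \<alpha> x y z" for x y z
    by (simp add: \<Psi>_def \<omega>_skew[of y x] D_skew[of y x])
  moreover have "\<Psi> \<alpha> x z y = - \<Psi> \<alpha> x y z" for x y z
    by (simp add: \<Psi>_def \<omega>_skew[of z y] D_skew[of z y])
  ultimately show ?thesis unfolding alternating3_def by blast
qed

text \<open>
  The kernel of \<open>\<langle>\<cdot>, e1\<rangle>\<close> is \<open>V \<oplus> \<real>U\<close>, and an alternating form vanishes as soon as \<open>U\<close> enters twice.
\<close>

lemma kernel_e1_decomp: "x \<bullet> e1 = 0 \<Longrightarrow> \<exists>X\<in>V. x = X + (x \<bullet> U) *\<^sub>R U"
  using decomp[of x] by simp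

lemma \<Psi>_eq_0_on_kernel_iff:
  assumes "linear \<alpha>"
  shows "(\<forall>x y z. x \<bullet> e1 = 0 \<longrightarrow> y \<bullet> e1 = 0 \<longrightarrow> z \<bullet> e1 = 0 \<longrightarrow> \<Psi> \<alpha> x y z = 0) \<longleftrightarrow>
    (\<forall>X\<in>V. \<forall>Y\<in>V. \<forall>Z\<in>V. \<Psi> \<alpha> X Y Z = 0) \<and> (\<forall>Y\<in>V. \<forall>Z\<in>V. \<Psi> \<alpha> U Y Z = 0)" (is "?L \<longleftrightarrow> ?R")
proof
  assume ?L
  then show ?R using perp by (auto simp: inner_commute)
next
  assume R: ?R
  note T = alternating3_\<Psi>[OF assms]
  have s: "\<Psi> \<alpha> y x z = - \<Psi> \<alpha> x y z" "\<Psi> \<alpha> x z y = - \<Psi> \<alpha> x y z" for x y z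
    using T unfolding alternating3_def by blast+
  have UU: "\<Psi> \<alpha> U U y = 0" "\<Psi> \<alpha> U y U = 0" "\<Psi> \<alpha> y U U = 0" for y
    using s(1)[of U U y] s(2)[of y U U] s(2)[of U U y] by auto
  show ?L
  proof (intro allI impI)
    fix x y z assume "x \<bullet> e1 = 0" "y \<bullet> e1 = 0" "z \<bullet> e1 = 0"
    then obtain X Y Z where XYZ: "X \<in> V" "Y \<in> V" "Z \<in> V" and
      xyz: "x = X + (x \<bullet> U) *\<^sub>R U" "y = Y + (y \<bullet> U) *\<^sub>R U" "z = Z + (z \<bullet> U) *\<^sub>R U"
      using kernel_e1_decomp by metis
    have 1: "\<Psi> \<alpha> X Y Z = 0" "\<Psi> \<alpha> U Y Z = 0" "\<Psi> \<alpha> X U Z = 0" "\<Psi> \<alpha> X Y U = 0"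
      using R XYZ s(1)[of X U Z] s(2)[of X Y U] s(1)[of X U Y] by auto
    have "\<Psi> \<alpha> (X + b *\<^sub>R U) (Y + c *\<^sub>R U) (Z + d *\<^sub>R U) = 0" for b c d
      unfolding alternating3_lin[OF T] by (simp add: 1 UU)
    then show "\<Psi> \<alpha> x y z = 0" using xyz by metis
  qed
qed

section \<open>The conditions on the maximal complex subspace of the ideal\<close>

lemma A_J_inner:
  assumes "X \<in> V"
  shows "A (J X) \<bullet> y = - (A X \<bullet> J y)"
  using A(2)[OF assms] J_skew by simp

lemma \<omega>_V:
  assumes "Y \<in> V" "Z \<in> V"
  shows "\<omega> Y Z = A (J Y) \<bullet> Z + A Z \<bullet> J Y"
  using assms V(2) by (simp add: \<omega>_def br_U A_J_inner[of Z])

lemma \<omega>_sym_part: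
  assumes "Y \<in> V" "Z \<in> V"
  shows "\<omega> Y Z = 2 * (sym_part_on V A (J Y) \<bullet> Z)"
  using assms by (simp add: \<omega>_V inner_sym_part_on[OF V(1) A(1)])

lemma \<omega>_U:
  assumes "Z \<in> V"
  shows "\<omega> U Z = - (v \<bullet> Z)"
  using perp(1)[OF assms] bilinear_rneg[OF br(1), of U e1]
  by (simp add: \<omega>_def J_U br_U_e1 br_U_inner_U inner_diff_left inner_commute[of e1])

lemma endo_on_quadratic_combination:
  "endo_on V (\<lambda>X. c *\<^sub>R A X + A (A X) + transpose_on V A (A X))"
proof -
  have t: "endo_on V (transpose_on V A)"
    using V(1) A(1) by (rule endo_on_transpose_on)
  show ?thesis
    using A(1) t V(1) unfolding endo_on_def
    by (auto simp: subspace_add subspace_scale scaleR_add_right)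
qed

text \<open>
  Moving \<open>J\<close> and \<open>A\<close> across the inner product turns \<open>\<omega>(A Y, Z) + \<omega>(Y, A Z)\<close> into
  \<open>2 \<langle>S(A\<^sup>2 + A\<^sup>tA) J Y, Z\<rangle>\<close>.
\<close>

lemma D_\<omega>_sym_part:
  assumes Y: "Y \<in> V" and Z: "Z \<in> V"
  shows "D_\<omega> Y Z + c * \<omega> Y Z =
    2 * (sym_part_on V (\<lambda>X. (a + c) *\<^sub>R A X + A (A X) + transpose_on V A (A X)) (J Y) \<bullet> Z)"
proof -
  have t: "transpose_on V A y \<bullet> X = y \<bullet> A X" if "X \<in> V" for X y
    using inner_transpose_on[OF V(1) A(1) that, of y] by (simp add: inner_commute)
  have JA: "J (A Y) = A (J Y)" "J (A Z) = A (J Z)"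
    using A(2) Y Z by auto
  have 1: "\<omega> (A Y) Z = A (A (J Y)) \<bullet> Z + A Z \<bullet> A (J Y)"
    using \<omega>_V[OF A_in[OF Y] Z] JA by simp
  have "A (J (A Z)) \<bullet> Y = - (A (A Z) \<bullet> J Y)"
    by (rule A_J_inner) (rule A_in[OF Z])
  moreover have "A Y \<bullet> J (A Z) = - (A (J Y) \<bullet> A Z)"
    using A_J_inner[OF Y, of "A Z"] by simp
  ultimately have 2: "\<omega> (A Z) Y = - (A (A Z) \<bullet> J Y) - A (J Y) \<bullet> A Z"
    using \<omega>_V[OF A_in[OF Z] Y] by simp
  show ?thesis
    unfolding inner_sym_part_on[OF V(1) endo_on_quadratic_combination Z]
    using V(2) Y Z
    by (simp add: D_\<omega>_def br_U 1 2 \<omega>_V t inner_left_distrib inner_commute[of "A Z" "A (J Y)"] algebra_simps)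
qed

lemma \<Psi>_V_eq_0_iff:
  assumes "X \<in> V" "Y \<in> V" "Z \<in> V"
  shows "\<Psi> \<alpha> X Y Z = 0 \<longleftrightarrow>
    \<alpha> X * (sym_part_on V A (J Y) \<bullet> Z) - \<alpha> Y * (sym_part_on V A (J X) \<bullet> Z)
      + \<alpha> Z * (sym_part_on V A (J X) \<bullet> Y) = 0"
proof -
  have "\<Psi> \<alpha> X Y Z = 2 * (\<alpha> X * (sym_part_on V A (J Y) \<bullet> Z)
    - \<alpha> Y * (sym_part_on V A (J X) \<bullet> Z) + \<alpha> Z * (sym_part_on V A (J X) \<bullet> Y))"
    using assms by (simp add: \<Psi>_def perp(2) \<omega>_sym_part algebra_simps)
  then show ?thesis by (simp only: mult_eq_0_iff) simp
qed

lemma \<Psi>_U_eq_0_iff: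
  assumes "Y \<in> V" "Z \<in> V"
  shows "\<Psi> \<alpha> U Y Z = 0 \<longleftrightarrow>
    sym_part_on V (\<lambda>X. (a + \<alpha> U) *\<^sub>R A X + A (A X) + transpose_on V A (A X)) (J Y) \<bullet> Z
      = (1/2) * ((v \<bullet> Y) * \<alpha> Z - (v \<bullet> Z) * \<alpha> Y)"
proof -
  have "\<Psi> \<alpha> U Y Z = D_\<omega> Y Z + \<alpha> U * \<omega> Y Z - ((v \<bullet> Y) * \<alpha> Z - (v \<bullet> Z) * \<alpha> Y)"
    using assms by (simp add: \<Psi>_def perp(2) U_unit \<omega>_U)
  moreover have "p = 2 * s - t \<Longrightarrow> p = 0 \<longleftrightarrow> s = (1/2) * t" for p s t :: real
    by auto
  ultimately show ?thesis unfolding D_\<omega>_sym_part[OF assms] by blast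
qed

lemma torsion_equation_iff:
  assumes "linear \<alpha>"
  shows "(\<forall>xs. length xs = 4 \<longrightarrow>
      ce_diff br (bismut_torsion br J) xs = wedge_one \<alpha> (bismut_torsion br J) xs) \<longleftrightarrow>
    (\<forall>X\<in>V. \<forall>Y\<in>V. \<forall>Z\<in>V.
      \<alpha> X * (sym_part_on V A (J Y) \<bullet> Z) - \<alpha> Y * (sym_part_on V A (J X) \<bullet> Z)
        + \<alpha> Z * (sym_part_on V A (J X) \<bullet> Y) = 0) \<and>
    (\<forall>Y\<in>V. \<forall>Z\<in>V.
      sym_part_on V (\<lambda>X. (a + \<alpha> U) *\<^sub>R A X + A (A X) + transpose_on V A (A X)) (J Y) \<bullet> Z
        = (1/2) * ((v \<bullet> Y) * \<alpha> Z - (v \<bullet> Z) * \<alpha> Y))" (is "?L \<longleftrightarrow> ?R")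
proof -
  have "?L \<longleftrightarrow> (\<forall>x y z w. (x \<bullet> e1) * \<Psi> \<alpha> y z w - (y \<bullet> e1) * \<Psi> \<alpha> x z w
      + (z \<bullet> e1) * \<Psi> \<alpha> x y w - (w \<bullet> e1) * \<Psi> \<alpha> x y z = 0)"
    unfolding all_length_4 lcskt_defect_eq[symmetric] by simp
  also have "\<dots> \<longleftrightarrow>
      (\<forall>x y z. x \<bullet> e1 = 0 \<longrightarrow> y \<bullet> e1 = 0 \<longrightarrow> z \<bullet> e1 = 0 \<longrightarrow> \<Psi> \<alpha> x y z = 0)"
    using wedge_alternating3_eq_0_iff[OF alternating3_\<Psi>[OF assms], of "\<lambda>x. x \<bullet> e1" e1] e1(1)
    by (simp add: bounded_linear.linear[OF bounded_linear_inner_left])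
  also have "\<dots> \<longleftrightarrow> ?R"
    unfolding \<Psi>_eq_0_on_kernel_iff[OF assms] using \<Psi>_V_eq_0_iff \<Psi>_U_eq_0_iff by simp
  finally show ?thesis .
qed

end

section \<open>Adapted bases\<close>

lemma orthogonal_span_image:
  assumes "\<And>i. i \<in> I \<Longrightarrow> e i \<bullet> u = 0" and "X \<in> span (e ` I)"
  shows "X \<bullet> u = 0"
proof -
  have "subspace {x. x \<bullet> u = 0}"
    by (simp add: subspace_def inner_left_distrib)
  then have "span (e ` I) \<subseteq> {x. x \<bullet> u = 0}"
    using assms(1) by (intro span_minimal) auto
  then show ?thesis using assms(2) by auto
qed

lemma almost_abelian_hermitian_adapted_basis:
  fixes br :: "'a::euclidean_space \<Rightarrow> 'a \<Rightarrow> 'a"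
  assumes n: "DIM('a) = 2 * n"
    and lie: "lie_bracket br"
    and herm: "hermitian_structure br J"
    and ideal: "codim_one_abelian_ideal br N"
    and basis: "adapted_basis J N n e"
    and V: "V = N \<inter> J ` N"
    and v: "v \<in> V"
    and A: "endo_on V A" "\<forall>X\<in>V. A (J X) = J (A X)"
    and br_U: "br (e (2*n)) (e 1) = a *\<^sub>R e 1 + v" "\<forall>X\<in>V. br (e (2*n)) X = A X"
  shows "almost_abelian_hermitian br J A V (e 1) (e (2*n)) v a"
proof -
  let ?U = "e (2*n)"
  have n1: "n \<ge> 1" using n ideal unfolding codim_one_abelian_ideal_def by linarith
  have J: "linear J" "J (J x) = - x" "J x \<bullet> J y = x \<bullet> y" for x y
    using herm unfolding hermitian_structure_def by auto
  have orth: "e i \<bullet> e j = (if i = j then 1 else 0)" if "i \<in> {1..2*n}" "j \<in> {1..2*n}" for i j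
    using basis that unfolding adapted_basis_def by blast
  have Vspan: "V = span (e ` {2..2*n-1})" and Nspan: "N = span (e ` {1..2*n-1})"
    and all: "span (e ` {1..2*n}) = UNIV" and Je: "J (e 1) = ?U"
    using basis V n1 unfolding adapted_basis_def by auto
  have subN: "subspace N" and ab: "\<And>x y. x \<in> N \<Longrightarrow> y \<in> N \<Longrightarrow> br x y = 0"
    using ideal unfolding codim_one_abelian_ideal_def by auto
  have perp1: "X \<bullet> e 1 = 0" and perpU: "X \<bullet> ?U = 0" if "X \<in> V" for X
  proof -
    have "e i \<bullet> e 1 = 0" "e i \<bullet> ?U = 0" if "i \<in> {2..2*n-1}" for i
      using that orth[of i 1] orth[of i "2*n"] by auto
    then show "X \<bullet> e 1 = 0" "X \<bullet> ?U = 0"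
      using that orthogonal_span_image[of "{2..2*n-1}" e _ X] unfolding Vspan by blast+
  qed
  have "{1..2*n} = insert 1 (insert (2*n) {2..2*n-1})" using n1 by auto
  then have all': "span (insert (e 1) (insert ?U (e ` {2..2*n-1}))) = UNIV"
    using all by simp
  have e1: "e 1 \<bullet> e 1 = 1" "?U \<bullet> ?U = 1" "e 1 \<bullet> ?U = 0" "?U \<bullet> e 1 = 0"
    using orth n1 by auto
  have dec: "\<exists>X\<in>V. x = (x \<bullet> e 1) *\<^sub>R e 1 + X + (x \<bullet> ?U) *\<^sub>R ?U" for x
  proof -
    have "x \<in> span (insert (e 1) (insert ?U (e ` {2..2*n-1})))" using all' by simp
    then obtain k l where X: "x - k *\<^sub>R e 1 - l *\<^sub>R ?U \<in> V"
      unfolding span_insert[of "e 1"] span_insert[of ?U] Vspan by auto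
    have "k = x \<bullet> e 1" "l = x \<bullet> ?U"
      using perp1[OF X] perpU[OF X] e1 by (auto simp: inner_diff_left)
    then show ?thesis using X by (intro bexI[OF _ X]) simp
  qed
  have VN: "V \<subseteq> N" using V by auto
  have e1N: "e 1 \<in> N" unfolding Nspan using n1 by (intro span_base) auto
  have inN: "x \<in> N" if x: "x \<bullet> ?U = 0" for x
  proof -
    obtain X where "X \<in> V" "x = (x \<bullet> e 1) *\<^sub>R e 1 + X" using dec[of x] x by auto
    then show ?thesis using VN e1N subN by (metis subsetD subspace_add subspace_scale)
  qed
  have JV: "J X \<in> V" if X: "X \<in> V" for X
  proof -
    obtain y where y: "y \<in> N" "X = J y" using X V by auto
    have "J X \<in> N" using y J(2) subN by (simp add: subspace_neg)
    then show ?thesis using X V by auto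
  qed
  show ?thesis
  proof (rule almost_abelian_hermitian.intro)
    show "bilinear br" "br x x = 0" for x
      using lie unfolding lie_bracket_def by auto
    show "subspace V" unfolding Vspan by simp
    show "br x y = 0" if "x \<bullet> ?U = 0" "y \<bullet> ?U = 0" for x y
      using ab inN that by blast
  qed (use J JV A v br_U e1 Je perp1 perpU dec in auto)
qed

section \<open>The characterization\<close>

theorem proposition4p1:
  fixes br :: "'a::euclidean_space \<Rightarrow> 'a \<Rightarrow> 'a"
    and J A :: "'a \<Rightarrow> 'a"
    and N N1 :: "'a set"
    and n :: nat
    and e :: "nat \<Rightarrow> 'a"
    and a :: real
    and v :: 'a
  assumes "DIM('a) = 2 * n"
    and "lie_bracket br"
    and "hermitian_structure br J"
    and "codim_one_abelian_ideal br N"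
    and "adapted_basis J N n e"
    and "N1 = N \<inter> J ` N"
    and "v \<in> N1"
    and "endo_on N1 A"
    and "\<forall>X\<in>N1. A (J X) = J (A X)"
    and "br (e (2*n)) (e 1) = a *\<^sub>R e 1 + v"
    and "\<forall>X\<in>N1. br (e (2*n)) X = A X"
  shows "lcskt br J \<longleftrightarrow>
    (\<exists>\<alpha>. closed_one_form br \<alpha> \<and> \<alpha> \<noteq> (\<lambda>_. 0) \<and>
       a * \<alpha> (e 1) + \<alpha> v = 0 \<and>
       (\<forall>X\<in>N1. \<alpha> (A X) = 0) \<and>
       (\<forall>X\<in>N1. \<forall>Y\<in>N1. \<forall>Z\<in>N1.
          \<alpha> X * (sym_part_on N1 A (J Y) \<bullet> Z) - \<alpha> Y * (sym_part_on N1 A (J X) \<bullet> Z)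
            + \<alpha> Z * (sym_part_on N1 A (J X) \<bullet> Y) = 0) \<and>
       (\<forall>Y\<in>N1. \<forall>Z\<in>N1.
          sym_part_on N1
            (\<lambda>X. (a + \<alpha> (e (2*n))) *\<^sub>R A X + A (A X) + transpose_on N1 A (A X)) (J Y) \<bullet> Z
          = (1/2) * ((v \<bullet> Y) * \<alpha> Z - (v \<bullet> Z) * \<alpha> Y)))"
proof -
  interpret almost_abelian_hermitian br J A N1 "e 1" "e (2*n)" v a
    using assms by (rule almost_abelian_hermitian_adapted_basis)
  (* The first two conditions hold for every closed form, so only the last two constrain it. *)
  have "a * \<alpha> (e 1) + \<alpha> v = 0 \<and> (\<forall>X\<in>N1. \<alpha> (A X) = 0)" if "closed_one_form br \<alpha>" for \<alpha>
  proof -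
    have lin: "linear \<alpha>" and 0: "\<alpha> (br x y) = 0" for x y
      using that by (auto simp: closed_one_form_iff)
    show ?thesis using 0[of "e (2*n)" "e 1"] 0[of "e (2*n)"]
      by (auto simp: br_U_e1 br_U[symmetric] linear_add[OF lin] linear_scale[OF lin]
          simp del: One_nat_def)
  qed
  moreover have "linear \<alpha>" if "closed_one_form br \<alpha>" for \<alpha>
    using that by (simp add: closed_one_form_iff)
  ultimately show ?thesis
    unfolding lcskt_def using torsion_equation_iff by (intro ex_cong1) blast
qed

end
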